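(* Every regular tournament with $n$ vertices contains at least $\frac{1}{8+\sqrt{32}}\,n^2\,(1-o(1))$ pairwise arc-disjoint copies of $C_4$, where the $o(1)$ term tends to zero as $n$ tends to infinity. That is: for every $\epsilon>0$ there exists $N$ such that for all $n>N$, every regular tournament with $n$ vertices contains at least $\frac{1}{8+\sqrt{32}}\,n^2\,(1-\epsilon)$ pairwise arc-disjoint copies of $C_4$.
   Context: A tournament is an orientation of a complete graph. A regular (also called Eulerian) tournament is a tournament in which every vertex has indegree equal to its outdegree. $C_4$ denotes the directed cycle on four vertices. A copy of $C_4$ in a digraph is a (not necessarily induced) subdigraph isomorphic to $C_4$; copies are arc-disjoint if no two of them share an arc. *)

theory Defs
  imports Complex_Main "Graph_Theory.Graph_Theory"
begin

locale tournament = digraph T for T :: "('a, 'b) pre_digraph" +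
  assumes orientation:
    "\<lbrakk>u \<in> verts T; v \<in> verts T; u \<noteq> v\<rbrakk> \<Longrightarrow> u \<rightarrow>\<^bsub>T\<^esub> v \<longleftrightarrow> \<not> v \<rightarrow>\<^bsub>T\<^esub> u"

locale regular_tournament = tournament T for T :: "('a, 'b) pre_digraph" +
  assumes regular: "v \<in> verts T \<Longrightarrow> in_degree T v = out_degree T v"

definition directed_cycle :: "nat \<Rightarrow> (nat, nat \<times> nat) pre_digraph" where
  "directed_cycle k =
     with_proj \<lparr>pverts = {..<k}, parcs = {(i, Suc i mod k) | i. i < k}\<rparr>"

text \<open>A subdigraph in the sense of \<^const>\<open>subgraph\<close> shares the tail and head functions of the
  host digraph, so it is determined by its vertex set and its arc set; distinct copies are
  therefore distinct as subdigraphs.\<close>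

definition is_copy :: "('a, 'b) pre_digraph \<Rightarrow> ('c, 'd) pre_digraph \<Rightarrow> ('a, 'b) pre_digraph \<Rightarrow> bool"
  where "is_copy H F G \<longleftrightarrow> subgraph H G \<and> digraph_iso H F"

definition arc_disjoint :: "('a, 'b) pre_digraph \<Rightarrow> ('a, 'b) pre_digraph \<Rightarrow> bool" where
  "arc_disjoint H K \<longleftrightarrow> arcs H \<inter> arcs K = {}"

end

theory Submission
  imports Defs "HOL-Combinatorics.Permutations" "HOL-Real_Asymp.Real_Asymp"
begin

text \<open>The four arcs of a directed 4-cycle \<open>x \<rightarrow> y \<rightarrow> z \<rightarrow> w \<rightarrow> x\<close> form a path of length two from \<open>x\<close> to \<open>z\<close>
  and another one back from \<open>z\<close> to \<open>x\<close>. In a regular tournament the numbers of paths of length two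
  from \<open>x\<close> to \<open>z\<close> and from \<open>z\<close> to \<open>x\<close> differ by at most one, whatever \<open>x\<close> and \<open>z\<close> are. So if arc-disjoint
  paths of length two are selected in such a way that every path has about the same chance, the selected
  paths from \<open>x\<close> to \<open>z\<close> can be matched with those from \<open>z\<close> to \<open>x\<close> with little loss.

  To have many selected paths for each pair that occurs, the end points are restricted to pairs inside
  small blocks. The vertices are ordered and cut into blocks of \<open>K\<close> consecutive vertices, and a block
  \<open>S\<close> uses as middle vertices all the vertices that precede it. A middle vertex \<open>y\<close> splits \<open>S\<close> into
  in-neighbours and out-neighbours, and selecting arc-disjoint paths through \<open>y\<close> means selecting a
  matching between the two parts. If both have size at most \<open>D\<close>, the complete bipartite graph between
  them decomposes into \<open>D\<close> matchings, and distributing these evenly over the vertices \<open>y\<close> that split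
  \<open>S\<close> in the same way selects each path for a proportion \<open>1 / D\<close> of the \<open>y\<close>
  (\<open>matching_selection\<close>). When \<open>D\<close> is only slightly larger than \<open>K / 2\<close>, nearly all arcs are used,
  provided that most \<open>y\<close> split \<open>S\<close> nearly evenly and that the vertices of \<open>S\<close> have nearly the same
  number of in-neighbours and out-neighbours among the preceding vertices (\<open>block_packing\<close>).

  A random order achieves both: regularity makes the signs in a row of the adjacency matrix sum to zero,
  hence negatively correlated, and a second moment computation suffices
  (\<open>balanced_ordering\<close>). The resulting packing has \<open>c n\<^sup>2 - O(n powr (3 / 2))\<close> cycles, where \<open>c\<close>
  approaches the optimal value \<open>1 / 8\<close> as \<open>K\<close> grows; \<open>K = 10000\<close> gives more than is needed.\<close>

section \<open>Packings of directed 4-cycles in a relation\<close>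

text \<open>A quadruple \<open>(x, y, z, w)\<close> stands for the closed walk \<open>x \<rightarrow> y \<rightarrow> z \<rightarrow> w \<rightarrow> x\<close>, represented by the
  ordered pairs that it traverses. If these pairs lie in an antisymmetric irreflexive relation,
  the four vertices are distinct and the walk is a directed 4-cycle.\<close>

definition c4_arcs :: "'a \<times> 'a \<times> 'a \<times> 'a \<Rightarrow> ('a \<times> 'a) set" where
  "c4_arcs = (\<lambda>(x, y, z, w). {(x, y), (y, z), (z, w), (w, x)})"

text \<open>The distinctness of the vertices is not required here; it follows from \<open>E\<close> being the arc relation
  of a tournament. The rotations of one 4-cycle are different quadruples, but they share arcs, so a
  packing contains at most one of them.\<close>

definition c4_packing :: "('a \<times> 'a) set \<Rightarrow> ('a \<times> 'a \<times> 'a \<times> 'a) set \<Rightarrow> bool" where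
  "c4_packing E Q \<longleftrightarrow> finite Q \<and> (\<forall>q\<in>Q. c4_arcs q \<subseteq> E) \<and>
     pairwise (\<lambda>p q. c4_arcs p \<inter> c4_arcs q = {}) Q"

text \<open>The skew-symmetric matrix of an oriented graph: \<open>1\<close> on an arc, \<open>-1\<close> on a reversed arc, and \<open>0\<close>
  otherwise. A tournament is regular iff all row sums vanish.\<close>

definition sgn_arc :: "('a \<times> 'a) set \<Rightarrow> 'a \<Rightarrow> 'a \<Rightarrow> real" where
  "sgn_arc E a b = of_bool ((a, b) \<in> E) - of_bool ((b, a) \<in> E)"

lemma c4_packing_image:
  assumes Q: "c4_packing F Q" and F: "F \<subseteq> X \<times> X" and inj: "inj_on g X"
    and hom: "\<And>a b. (a, b) \<in> F \<Longrightarrow> (g a, g b) \<in> E"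
  shows "\<exists>R. c4_packing E R \<and> card R = card Q"
proof -
  define G where "G = (\<lambda>(x, y, z, w). (g x, g y, g z, g w))"
  have arcs_F: "c4_arcs q \<subseteq> F" if "q \<in> Q" for q using Q that by (simp add: c4_packing_def)
  have arcs_G: "c4_arcs (G q) = map_prod g g ` c4_arcs q" for q
    by (cases q) (simp add: G_def c4_arcs_def)
  have injG: "inj_on G Q"
  proof (rule inj_onI)
    fix p q assume pq: "p \<in> Q" "q \<in> Q" "G p = G q"
    obtain x y z w x' y' z' w' where "p = (x, y, z, w)" "q = (x', y', z', w')"
      by (metis prod_cases4)
    then show "p = q" using pq arcs_F[of p] arcs_F[of q] F inj
      by (auto simp: c4_arcs_def G_def inj_on_def)
  qed
  have injF: "inj_on (map_prod g g) F"
    using map_prod_inj_on[OF inj inj] F by (rule inj_on_subset)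
  have "c4_packing E (G ` Q)"
    unfolding c4_packing_def pairwise_def
  proof (intro conjI ballI impI)
    show "finite (G ` Q)" using Q by (simp add: c4_packing_def)
  next
    fix q assume "q \<in> G ` Q"
    then show "c4_arcs q \<subseteq> E" using arcs_F arcs_G hom by fastforce
  next
    fix p q assume "p \<in> G ` Q" "q \<in> G ` Q" "p \<noteq> q"
    then obtain p' q' where *: "p' \<in> Q" "q' \<in> Q" "p' \<noteq> q'" "p = G p'" "q = G q'" by blast
    then have "c4_arcs p' \<inter> c4_arcs q' = {}" using Q by (auto simp: c4_packing_def pairwise_def)
    then show "c4_arcs p \<inter> c4_arcs q = {}"
      using inj_on_image_Int[OF injF arcs_F[of p'] arcs_F[of q']] * arcs_G by simp
  qed
  then show ?thesis using card_image[OF injG] by blast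
qed

lemma c4_packing_UN:
  fixes E :: "('a \<times> 'a) set"
  assumes "finite J" and Q: "\<And>j. j \<in> J \<Longrightarrow> c4_packing E (Q j)"
    and disj: "\<And>i j p q. i \<in> J \<Longrightarrow> j \<in> J \<Longrightarrow> i \<noteq> j \<Longrightarrow> p \<in> Q i \<Longrightarrow> q \<in> Q j \<Longrightarrow> c4_arcs p \<inter> c4_arcs q = {}"
  shows "c4_packing E (\<Union>j\<in>J. Q j)" "card (\<Union>j\<in>J. Q j) = (\<Sum>j\<in>J. card (Q j))"
proof -
  have fin: "finite (Q j)" if "j \<in> J" for j using Q[OF that] by (simp add: c4_packing_def)
  show "c4_packing E (\<Union>j\<in>J. Q j)"
    unfolding c4_packing_def pairwise_def
  proof (intro conjI ballI impI)
    show "finite (\<Union>j\<in>J. Q j)" using assms(1) fin by blast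
  next
    fix q assume "q \<in> (\<Union>j\<in>J. Q j)"
    then show "c4_arcs q \<subseteq> E" using Q by (auto simp: c4_packing_def)
  next
    fix p q assume "p \<in> (\<Union>j\<in>J. Q j)" "q \<in> (\<Union>j\<in>J. Q j)" and ne: "p \<noteq> q"
    then obtain i j where ij: "i \<in> J" "j \<in> J" "p \<in> Q i" "q \<in> Q j" by blast
    show "c4_arcs p \<inter> c4_arcs q = {}"
    proof (cases "i = j")
      case True
      then show ?thesis using Q[OF ij(1)] ij ne by (auto simp: c4_packing_def pairwise_def)
    next
      case False
      then show ?thesis using disj ij by blast
    qed
  qed
  have ne: "c4_arcs q \<noteq> {}" for q :: "'a \<times> 'a \<times> 'a \<times> 'a" by (cases q) (simp add: c4_arcs_def)
  have "Q i \<inter> Q j = {}" if "i \<in> J" "j \<in> J" "i \<noteq> j" for i j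
  proof -
    have "q \<notin> Q j" if "q \<in> Q i" for q
      using disj[OF \<open>i \<in> J\<close> \<open>j \<in> J\<close> \<open>i \<noteq> j\<close> that, of q] ne[of q] by auto
    then show ?thesis by auto
  qed
  then show "card (\<Union>j\<in>J. Q j) = (\<Sum>j\<in>J. card (Q j))"
    using assms(1) fin by (intro card_UN_disjoint) blast+
qed

section \<open>Choosing matchings at the vertices outside a block\<close>

lemma equitable_colouring:
  fixes A :: "'a set" and D :: nat
  assumes "finite A" "D > 0"
  shows "\<exists>col. \<forall>c<D. real (card A) / real D - 1 \<le> real (card {a \<in> A. col a = c})"
proof -
  obtain h where h: "bij_betw h A {..<card A}"
    using ex_bij_betw_finite_nat[OF assms(1)] by (auto simp: atLeast0LessThan)
  show ?thesis
  proof (intro exI allI impI)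
    fix c assume c: "c < D"
    let ?C = "{a \<in> A. h a mod D = c}"
    have sub: "(\<lambda>q. q * D + c) ` {..<card A div D} \<subseteq> h ` ?C"
    proof
      fix i assume "i \<in> (\<lambda>q. q * D + c) ` {..<card A div D}"
      then obtain q where q: "q < card A div D" "i = q * D + c" by auto
      have "q * D + c < (q + 1) * D" using c by simp
      also have "\<dots> \<le> (card A div D) * D" using q by (intro mult_right_mono) auto
      also have "\<dots> \<le> card A" by simp
      finally have "i \<in> h ` A" using h q by (simp add: bij_betw_def)
      then obtain a where "a \<in> A" "i = h a" by blast
      moreover have "i mod D = c" using q c by simp
      ultimately show "i \<in> h ` ?C" by blast
    qed
    have "card A div D = card ((\<lambda>q. q * D + c) ` {..<card A div D})"
      using assms(2) by (subst card_image) (auto simp: inj_on_def)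
    also have "\<dots> \<le> card (h ` ?C)" using assms(1) sub by (intro card_mono) auto
    also have "\<dots> \<le> card ?C" using assms(1) by (intro card_image_le) auto
    finally have "real (card A div D) \<le> real (card ?C)" by simp
    moreover have "real (card A) / real D - 1 \<le> real (card A div D)"
      using floor_divide_of_nat_eq[of "card A" D, where ?'a = real] by linarith
    ultimately show "real (card A) / real D - 1 \<le> real (card ?C)" by linarith
  qed
qed

lemma rank_inj:
  fixes x y :: "'a :: linorder"
  assumes "finite I" "x \<in> I" "y \<in> I" "card {a \<in> I. a < x} = card {a \<in> I. a < y}"
  shows "x = y"
proof -
  have *: "card {a \<in> I. a < x} < card {a \<in> I. a < y}" if "x < y" "x \<in> I" for x y
    using assms(1) that by (intro psubset_card_mono) auto
  show ?thesis using *[of x y] *[of y x] assms by (cases x y rule: linorder_cases) auto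
qed

lemma rank_less:
  fixes x :: "'a :: linorder"
  assumes "finite I" "x \<in> I"
  shows "card {a \<in> I. a < x} < card I"
  using assms by (intro psubset_card_mono) auto

lemma add_mod_cancel:
  fixes i j k D :: nat
  assumes "(k + i) mod D = (k + j) mod D" "i \<le> j" "j < D"
  shows "i = j"
proof -
  have "D dvd (k + j) - (k + i)"
    using assms by (subst mod_eq_dvd_iff_nat[symmetric]) auto
  then show ?thesis using assms by (auto dest: dvd_imp_le)
qed

text \<open>Here \<open>S\<close> is a block, and each \<open>y \<in> U\<close> splits it into the in-neighbours and the out-neighbours of \<open>y\<close>.
  The set \<open>A x z\<close> consists of the \<open>y\<close> at which the path \<open>x \<rightarrow> y \<rightarrow> z\<close> is selected; the paths selected
  at one \<open>y\<close> are arc-disjoint, which is to say that they form a matching between its in- and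
  out-neighbours. When both sides have at most \<open>D\<close> vertices, the complete bipartite graph between them
  is properly coloured with \<open>D\<close> colours by the sum of the ranks modulo \<open>D\<close>, and \<open>y\<close> selects one colour
  class. Vertices \<open>y\<close> with the same in-neighbours in \<open>S\<close> have the same coloured graph; among them the
  colours are chosen equally often up to rounding. Hence \<open>x \<rightarrow> y \<rightarrow> z\<close> is selected for a proportion
  \<open>1 / D\<close> of the admissible \<open>y\<close>, and the rounding costs at most 1 for each of the at most \<open>2 ^ card S\<close>
  possible in-neighbourhoods.\<close>

lemma matching_selection:
  fixes S U :: "'a :: linorder set" and E :: "('a \<times> 'a) set" and D :: nat
  defines "G \<equiv> {y \<in> U. card {x \<in> S. (x, y) \<in> E} \<le> D \<and> card {x \<in> S. (y, x) \<in> E} \<le> D}"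
  defines "P \<equiv> \<lambda>x z. {y \<in> G. (x, y) \<in> E \<and> (y, z) \<in> E}"
  assumes fin: "finite S" "finite U" and D: "D > 0"
    and orient: "\<And>x y. x \<in> S \<Longrightarrow> y \<in> U \<Longrightarrow> (x, y) \<in> E \<longleftrightarrow> (y, x) \<notin> E"
  obtains A where
    "\<And>x z. A x z \<subseteq> P x z"
    "\<And>x z. x \<in> S \<Longrightarrow> z \<in> S \<Longrightarrow> real (card (P x z)) / real D - 2 ^ card S \<le> real (card (A x z))"
    "\<And>x z z'. x \<in> S \<Longrightarrow> z \<in> S \<Longrightarrow> z' \<in> S \<Longrightarrow> z \<noteq> z' \<Longrightarrow> A x z \<inter> A x z' = {}"
    "\<And>x x' z. x \<in> S \<Longrightarrow> x' \<in> S \<Longrightarrow> z \<in> S \<Longrightarrow> x \<noteq> x' \<Longrightarrow> A x z \<inter> A x' z = {}"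
proof -
  define In where "In = (\<lambda>y. {x \<in> S. (x, y) \<in> E})"
  define Out where "Out = (\<lambda>y. {x \<in> S. (y, x) \<in> E})"
  define r where "r = (\<lambda>J x. card {a \<in> J. a < (x :: 'a)})"
  define C where "C = (\<lambda>J. {y \<in> U. In y = J})"
  have finG: "finite G" using fin by (simp add: G_def)
  have Out_eq: "Out y = S - In y" if "y \<in> U" for y
    using orient that by (auto simp: Out_def In_def)
  have "\<forall>J. \<exists>col. \<forall>c<D. real (card (C J)) / real D - 1 \<le> real (card {a \<in> C J. col a = c})"
    using fin D by (intro allI equitable_colouring) (auto simp: C_def)
  then obtain col where
    col: "\<And>J c. c < D \<Longrightarrow> real (card (C J)) / real D - 1 \<le> real (card {a \<in> C J. col J a = c})"
    by metis
  define A where "A = (\<lambda>x z. {y \<in> P x z. (r (In y) x + r (Out y) z) mod D = col (In y) y})"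
  have rI: "r (In y) x < D" if "y \<in> G" "x \<in> In y" for x y
    using rank_less[of "In y" x] fin that by (auto simp: r_def G_def In_def)
  have rO: "r (Out y) x < D" if "y \<in> G" "x \<in> Out y" for x y
    using rank_less[of "Out y" x] fin that by (auto simp: r_def G_def Out_def)
  have cancel: "i = j" if "(k + i) mod D = (k + j) mod D" "i < D" "j < D" for i j k :: nat
    using that by (metis add_mod_cancel nat_le_linear)
  show thesis
  proof
    show "A x z \<subseteq> P x z" for x z by (auto simp: A_def)
  next
    fix x z z' assume S: "x \<in> S" "z \<in> S" "z' \<in> S" and ne: "z \<noteq> z'"
    show "A x z \<inter> A x z' = {}"
    proof (rule ccontr)
      assume "A x z \<inter> A x z' \<noteq> {}"
      then obtain y where y: "y \<in> A x z" "y \<in> A x z'" by auto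
      then have "(r (In y) x + r (Out y) z) mod D = (r (In y) x + r (Out y) z') mod D"
        by (simp add: A_def)
      moreover have "z \<in> Out y" "z' \<in> Out y" "y \<in> G" using y S by (auto simp: A_def P_def Out_def)
      ultimately have "r (Out y) z = r (Out y) z'" using rO cancel by blast
      then show False using rank_inj[of "Out y" z z'] \<open>z \<in> Out y\<close> \<open>z' \<in> Out y\<close> fin ne
        by (auto simp: r_def Out_def)
    qed
  next
    fix x x' z assume S: "x \<in> S" "x' \<in> S" "z \<in> S" and ne: "x \<noteq> x'"
    show "A x z \<inter> A x' z = {}"
    proof (rule ccontr)
      assume "A x z \<inter> A x' z \<noteq> {}"
      then obtain y where y: "y \<in> A x z" "y \<in> A x' z" by auto
      then have "(r (Out y) z + r (In y) x) mod D = (r (Out y) z + r (In y) x') mod D"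
        by (simp add: A_def add.commute)
      moreover have "x \<in> In y" "x' \<in> In y" "y \<in> G" using y S by (auto simp: A_def P_def In_def)
      ultimately have "r (In y) x = r (In y) x'" using rI cancel by blast
      then show False using rank_inj[of "In y" x x'] \<open>x \<in> In y\<close> \<open>x' \<in> In y\<close> fin ne
        by (auto simp: r_def In_def)
    qed
  next
    fix x z assume S: "x \<in> S" "z \<in> S"
    have finP: "finite (P x z)" using finG by (simp add: P_def)
    have finA: "finite (A x z)" using finP by (simp add: A_def)
    have type: "real (card (P x z \<inter> C J)) / real D - 1 \<le> real (card (A x z \<inter> C J))" for J
    proof (cases "P x z \<inter> C J = {}")
      case True
      then show ?thesis by simp
    next
      case False
      then obtain y0 where y0: "y0 \<in> P x z" "y0 \<in> C J" by auto
      \<comment> \<open>Membership in \<open>P x z\<close> depends only on the in-neighbourhood in \<open>S\<close>.\<close>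
      have mem: "y \<in> P x z" "Out y = S - J" "In y = J" if "y \<in> C J" for y
      proof -
        have y: "y \<in> U" "In y = In y0" "In y = J" "y0 \<in> U" using that y0 by (auto simp: C_def)
        then have "Out y = Out y0" by (simp add: Out_eq)
        then have "y \<in> G" using y y0(1) unfolding P_def G_def In_def Out_def by auto
        moreover have "x \<in> In y" "z \<in> Out y" using y0(1) S y(2) \<open>Out y = Out y0\<close>
          by (auto simp: P_def In_def Out_def)
        ultimately show "y \<in> P x z" by (auto simp: P_def In_def Out_def)
        show "Out y = S - J" "In y = J" using y Out_eq by auto
      qed
      define c where "c = (r J x + r (S - J) z) mod D"
      have "A x z \<inter> C J = {a \<in> C J. col J a = c}"
        using mem by (auto simp: A_def c_def)
      moreover have "P x z \<inter> C J = C J" using mem by auto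
      moreover have "c < D" using D by (simp add: c_def)
      ultimately show ?thesis using col[of c J] by simp
    qed
    have split: "card X = (\<Sum>J\<in>Pow S. card (X \<inter> C J))" if "X \<subseteq> U" "finite X" for X
    proof -
      have "X = (\<Union>J\<in>Pow S. X \<inter> C J)" using that by (auto simp: C_def In_def)
      then have "card X = card (\<Union>J\<in>Pow S. X \<inter> C J)" by simp
      also have "\<dots> = (\<Sum>J\<in>Pow S. card (X \<inter> C J))"
        using that fin by (intro card_UN_disjoint) (auto simp: C_def)
      finally show ?thesis .
    qed
    have "real (card (P x z)) / real D - 2 ^ card S
        = (\<Sum>J\<in>Pow S. real (card (P x z \<inter> C J)) / real D - 1)"
      using split[OF _ finP] fin
      by (auto simp: P_def G_def sum_subtractf card_Pow sum_divide_distrib)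
    also have "\<dots> \<le> (\<Sum>J\<in>Pow S. real (card (A x z \<inter> C J)))"
      by (intro sum_mono type)
    also have "\<dots> = real (card (A x z))"
      using split[OF _ finA] by (auto simp: A_def P_def G_def)
    finally show "real (card (P x z)) / real D - 2 ^ card S \<le> real (card (A x z))" .
  qed
qed

section \<open>Many 4-cycles between a block and the vertices outside it\<close>

text \<open>For each pair \<open>x < z\<close> the selected paths \<open>x \<rightarrow> y \<rightarrow> z\<close> are matched with selected paths \<open>z \<rightarrow> w \<rightarrow> x\<close>,
  as many as possible.\<close>

lemma c4_packing_of_matchings:
  fixes S U :: "'a :: linorder set" and E :: "('a \<times> 'a) set" and A :: "'a \<Rightarrow> 'a \<Rightarrow> 'a set"
  assumes fin: "finite S" "finite U" and disj: "S \<inter> U = {}"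
    and path: "\<And>x y z. y \<in> A x z \<Longrightarrow> y \<in> U \<and> (x, y) \<in> E \<and> (y, z) \<in> E"
    and out: "\<And>x z z'. x \<in> S \<Longrightarrow> z \<in> S \<Longrightarrow> z' \<in> S \<Longrightarrow> z \<noteq> z' \<Longrightarrow> A x z \<inter> A x z' = {}"
    and inn: "\<And>x x' z. x \<in> S \<Longrightarrow> x' \<in> S \<Longrightarrow> z \<in> S \<Longrightarrow> x \<noteq> x' \<Longrightarrow> A x z \<inter> A x' z = {}"
  obtains Q where "c4_packing E Q" "Q \<subseteq> S \<times> U \<times> S \<times> U"
    "card Q = (\<Sum>(x, z) \<in> {(x, z) \<in> S \<times> S. x < z}. min (card (A x z)) (card (A z x)))"
proof -
  have finA: "finite (A x z)" for x z using path fin finite_subset[of "A x z" U] by blast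
  have "\<exists>B f. B \<subseteq> A x z \<and> f ` B \<subseteq> A z x \<and> inj_on f B \<and> card B = min (card (A x z)) (card (A z x))"
    for x z
  proof -
    obtain B where B: "B \<subseteq> A x z" "card B = min (card (A x z)) (card (A z x))"
      by (meson min.cobounded1 obtain_subset_with_card_n)
    then obtain f where "f ` B \<subseteq> A z x" "inj_on f B"
      using card_le_inj[of B "A z x"] finA finite_subset by (metis min.cobounded2)
    then show ?thesis using B by blast
  qed
  then obtain B f where B: "\<And>x z. B x z \<subseteq> A x z" "\<And>x z. f x z ` B x z \<subseteq> A z x"
    "\<And>x z. inj_on (f x z) (B x z)" "\<And>x z. card (B x z) = min (card (A x z)) (card (A z x))"
    by metis
  define L where "L = {(x, z) \<in> S \<times> S. x < z}"
  define W where "W = Sigma L (\<lambda>(x, z). B x z)"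
  define g where "g = (\<lambda>((x, z), y). (x, y, z, f x z y))"
  have finL: "finite L" unfolding L_def using fin by (auto intro: finite_subset[of _ "S \<times> S"])
  have finB: "finite (B x z)" for x z using B(1) finA finite_subset by blast
  have finW: "finite W" unfolding W_def using finL finB by (auto intro!: finite_SigmaI)
  have gW: "\<exists>x y z w. q = (x, y, z, w) \<and> x \<in> S \<and> z \<in> S \<and> x < z \<and> y \<in> B x z \<and> w = f x z y \<and>
      y \<in> A x z \<and> w \<in> A z x \<and> y \<in> U \<and> w \<in> U" if q: "q \<in> g ` W" for q
  proof -
    obtain x z y where *: "x \<in> S" "z \<in> S" "x < z" "y \<in> B x z" "q = (x, y, z, f x z y)"
      using q by (auto simp: g_def W_def L_def)
    then have "y \<in> A x z" "f x z y \<in> A z x" using B by blast+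
    then show ?thesis using * path by blast
  qed
  show thesis
  proof
    have inj: "inj_on g W" by (auto simp: inj_on_def g_def)
    show "c4_packing E (g ` W)"
      unfolding c4_packing_def pairwise_def
    proof (intro conjI ballI impI)
      show "finite (g ` W)" using finW by simp
    next
      fix q assume "q \<in> g ` W"
      from gW[OF this] show "c4_arcs q \<subseteq> E" using path by (auto simp: c4_arcs_def)
    next
      fix p q assume p: "p \<in> g ` W" and q: "q \<in> g ` W" and ne: "p \<noteq> q"
      obtain x y z w where P: "p = (x, y, z, w)" "x \<in> S" "z \<in> S" "x < z" "y \<in> B x z"
        "w = f x z y" "y \<in> A x z" "w \<in> A z x" "y \<in> U" "w \<in> U" using gW[OF p] by blast
      obtain x' y' z' w' where Q: "q = (x', y', z', w')" "x' \<in> S" "z' \<in> S" "x' < z'" "y' \<in> B x' z'"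
        "w' = f x' z' y'" "y' \<in> A x' z'" "w' \<in> A z' x'" "y' \<in> U" "w' \<in> U" using gW[OF q] by blast
      have same: "p = q" if "x = x'" "z = z'" "y = y' \<or> w = w'"
        using that P Q B(3)[of x z] by (auto simp: inj_on_def)
      have "(x, y) \<noteq> (x', y')" using out[of x z z'] P Q same ne by blast
      moreover have "(x, y) \<noteq> (z', w')" using out[of x z x'] P Q by force
      moreover have "(z, w) \<noteq> (x', y')" using out[of z x z'] P Q by force
      moreover have "(z, w) \<noteq> (z', w')" using out[of z x x'] P Q same ne by blast
      moreover have "(y, z) \<noteq> (y', z')" using inn[of x x' z] P Q same ne by blast
      moreover have "(y, z) \<noteq> (w', x')" using inn[of x z' z] P Q by force
      moreover have "(w, x) \<noteq> (y', z')" using inn[of z x' x] P Q by force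
      moreover have "(w, x) \<noteq> (w', x')" using inn[of z z' x] P Q same ne by blast
      moreover have "{x, z, x', z'} \<inter> {y, w, y', w'} = {}" using P Q disj by auto
      ultimately show "c4_arcs p \<inter> c4_arcs q = {}"
        unfolding P(1) Q(1) c4_arcs_def by auto
    qed
    show "g ` W \<subseteq> S \<times> U \<times> S \<times> U"
    proof
      fix q assume "q \<in> g ` W"
      from gW[OF this] show "q \<in> S \<times> U \<times> S \<times> U" by auto
    qed
    have "card (g ` W) = card W" by (rule card_image[OF inj])
    also have "\<dots> = (\<Sum>p\<in>L. card (case p of (x, z) \<Rightarrow> B x z))"
      unfolding W_def using finL finB by (intro card_SigmaI) auto
    also have "\<dots> = (\<Sum>(x, z) \<in> L. min (card (A x z)) (card (A z x)))"
      using B(4) by (intro sum.cong) auto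
    finally show "card (g ` W)
        = (\<Sum>(x, z) \<in> {(x, z) \<in> S \<times> S. x < z}. min (card (A x z)) (card (A z x)))"
      by (simp add: L_def)
  qed
qed

lemma sum_pairs_symmetric:
  fixes F :: "'a :: linorder \<Rightarrow> 'a \<Rightarrow> real"
  assumes "finite S" "\<And>x z. F x z = F z x" "\<And>x. x \<in> S \<Longrightarrow> F x x = 0"
  shows "(\<Sum>x\<in>S. \<Sum>z\<in>S. F x z) = 2 * (\<Sum>(x, z) \<in> {(x, z) \<in> S \<times> S. x < z}. F x z)"
proof -
  let ?L = "{(x, z) \<in> S \<times> S. x < z}" and ?G = "{(x, z) \<in> S \<times> S. z < x}"
    and ?D = "{(x, z) \<in> S \<times> S. x = z}"
  have fin: "finite ?L" "finite ?G" "finite ?D"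
    using assms(1) by (auto intro: finite_subset[of _ "S \<times> S"])
  have "(\<Sum>x\<in>S. \<Sum>z\<in>S. F x z) = (\<Sum>(x, z) \<in> S \<times> S. F x z)"
    by (rule sum.cartesian_product)
  also have "S \<times> S = ?L \<union> ?G \<union> ?D" by auto
  also have "(\<Sum>(x, z) \<in> ?L \<union> ?G \<union> ?D. F x z)
      = (\<Sum>(x, z) \<in> ?L. F x z) + (\<Sum>(x, z) \<in> ?G. F x z) + (\<Sum>(x, z) \<in> ?D. F x z)"
    using fin by (subst sum.union_disjoint, simp, simp, force)+ simp
  also have "(\<Sum>(x, z) \<in> ?D. F x z) = 0" using assms(3) by (intro sum.neutral) auto
  also have "(\<Sum>(x, z) \<in> ?G. F x z) = (\<Sum>(x, z) \<in> ?L. F x z)"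
    by (rule sum.reindex_bij_witness[of _ prod.swap prod.swap]) (auto simp: assms(2))
  finally show ?thesis by simp
qed

text \<open>Let \<open>p x z\<close> be the number of paths \<open>x \<rightarrow> y \<rightarrow> z\<close> with \<open>y \<in> U\<close>. The difference \<open>p x z - p z x\<close> is half
  the difference of the row sums of \<open>x\<close> and \<open>z\<close> over \<open>U\<close>, so the minimum of the two is close to
  their mean. The total of all \<open>p x z\<close> counts, for each \<open>y\<close>, the product of the numbers of its
  in-neighbours and out-neighbours in \<open>S\<close>.\<close>

lemma sum_min_two_paths:
  fixes S U :: "'a set" and E :: "('a \<times> 'a) set"
  defines "p \<equiv> \<lambda>x z. real (card {y \<in> U. (x, y) \<in> E \<and> (y, z) \<in> E})"
  defines "s \<equiv> sgn_arc E"
  assumes fin: "finite S" "finite U"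
    and orient: "\<And>x y. x \<in> S \<Longrightarrow> y \<in> U \<Longrightarrow> (x, y) \<in> E \<longleftrightarrow> (y, x) \<notin> E"
  shows "real (card S) ^ 2 * real (card U) / 4 - (\<Sum>y\<in>U. (\<Sum>x\<in>S. s y x) ^ 2) / 4
      - real (card S) / 2 * (\<Sum>x\<in>S. \<bar>\<Sum>y\<in>U. s x y\<bar>) \<le> (\<Sum>x\<in>S. \<Sum>z\<in>S. min (p x z) (p z x))"
proof -
  define e where "e = (\<lambda>a b. of_bool ((a, b) \<in> E) :: real)"
  define b where "b = (\<lambda>x. \<Sum>y\<in>U. s x y)"
  have s: "s x y = 2 * e x y - 1" "s y x = 1 - 2 * e x y" "e y x = 1 - e x y"
    if "x \<in> S" "y \<in> U" for x y
    using orient[OF that] by (auto simp: s_def sgn_arc_def e_def)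
  have p: "p x z = (\<Sum>y\<in>U. e x y * (1 - e z y))" if "x \<in> S" "z \<in> S" for x z
  proof -
    have "p x z = (\<Sum>y\<in>U. of_bool ((x, y) \<in> E \<and> (y, z) \<in> E))"
      using fin by (simp add: p_def Int_def sum.If_cases of_bool_def)
    also have "\<dots> = (\<Sum>y\<in>U. e x y * (1 - e z y))"
      using that orient by (intro sum.cong) (auto simp: e_def)
    finally show ?thesis .
  qed
  have diff: "p x z - p z x = (b x - b z) / 2" if "x \<in> S" "z \<in> S" for x z
  proof -
    have "b x - b z = (\<Sum>y\<in>U. 2 * (e x y * (1 - e z y) - e z y * (1 - e x y)))"
      unfolding b_def sum_subtractf[symmetric] 
      using that by (intro sum.cong) (simp_all add: s(1) algebra_simps)
    also have "\<dots> = 2 * (p x z - p z x)"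
      using that by (simp add: p sum_distrib_left[symmetric] sum_subtractf)
    finally show ?thesis by simp
  qed
  have min_ge: "(p x z + p z x) / 2 - (\<bar>b x\<bar> + \<bar>b z\<bar>) / 4 \<le> min (p x z) (p z x)"
    if "x \<in> S" "z \<in> S" for x z
    using diff[OF that] abs_ge_self[of "b x"] abs_ge_minus_self[of "b x"] abs_ge_self[of "b z"]
      abs_ge_minus_self[of "b z"] by (simp add: min_def field_simps)
  have P: "(\<Sum>x\<in>S. \<Sum>z\<in>S. p x z) = (\<Sum>y\<in>U. (real (card S) ^ 2 - (\<Sum>x\<in>S. s y x) ^ 2) / 4)"
  proof -
    have "(\<Sum>x\<in>S. \<Sum>z\<in>S. p x z) = (\<Sum>x\<in>S. \<Sum>z\<in>S. \<Sum>y\<in>U. e x y * (1 - e z y))"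
      using p by (intro sum.cong) auto
    also have "\<dots> = (\<Sum>x\<in>S. \<Sum>y\<in>U. \<Sum>z\<in>S. e x y * (1 - e z y))"
      by (intro sum.cong refl sum.swap)
    also have "\<dots> = (\<Sum>y\<in>U. \<Sum>x\<in>S. \<Sum>z\<in>S. e x y * (1 - e z y))"
      by (rule sum.swap)
    also have "\<dots> = (\<Sum>y\<in>U. (\<Sum>x\<in>S. e x y) * (\<Sum>z\<in>S. 1 - e z y))"
      by (simp add: sum_product)
    also have "\<dots> = (\<Sum>y\<in>U. (real (card S) ^ 2 - (\<Sum>x\<in>S. s y x) ^ 2) / 4)"
    proof (intro sum.cong refl)
      fix y assume y: "y \<in> U"
      have "(\<Sum>x\<in>S. s y x) = (\<Sum>x\<in>S. 1 - 2 * e x y)" using s y by (intro sum.cong) auto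
      then have t: "(\<Sum>x\<in>S. s y x) = real (card S) - 2 * (\<Sum>x\<in>S. e x y)"
        by (simp add: sum_subtractf sum_distrib_left)
      have o': "(\<Sum>z\<in>S. 1 - e z y) = real (card S) - (\<Sum>x\<in>S. e x y)"
        by (simp add: sum_subtractf)
      show "(\<Sum>x\<in>S. e x y) * (\<Sum>z\<in>S. 1 - e z y)
          = (real (card S) ^ 2 - (\<Sum>x\<in>S. s y x) ^ 2) / 4"
        unfolding t o' by (simp add: power2_eq_square field_simps)
    qed
    finally show ?thesis .
  qed
  have P': "(\<Sum>x\<in>S. \<Sum>z\<in>S. p z x) = (\<Sum>x\<in>S. \<Sum>z\<in>S. p x z)" by (rule sum.swap)
  have "(\<Sum>x\<in>S. \<Sum>z\<in>S. (p x z + p z x) / 2 - (\<bar>b x\<bar> + \<bar>b z\<bar>) / 4)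
      \<le> (\<Sum>x\<in>S. \<Sum>z\<in>S. min (p x z) (p z x))"
    by (intro sum_mono min_ge)
  also have "(\<Sum>x\<in>S. \<Sum>z\<in>S. (p x z + p z x) / 2 - (\<bar>b x\<bar> + \<bar>b z\<bar>) / 4)
      = (\<Sum>x\<in>S. \<Sum>z\<in>S. p x z) - real (card S) / 2 * (\<Sum>x\<in>S. \<bar>b x\<bar>)"
  proof -
    have B: "(\<Sum>x\<in>S. \<Sum>z\<in>S. \<bar>b x\<bar>) = real (card S) * (\<Sum>x\<in>S. \<bar>b x\<bar>)"
      "(\<Sum>x\<in>S. \<Sum>z\<in>S. \<bar>b z\<bar>) = real (card S) * (\<Sum>x\<in>S. \<bar>b x\<bar>)"
      by (simp_all add: sum_distrib_left)
    show ?thesis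
      by (simp only: sum_subtractf sum.distrib sum_divide_distrib[symmetric] P' B) simp
  qed
  finally show ?thesis
    unfolding P b_def by (simp add: sum_subtractf sum_divide_distrib[symmetric] field_simps)
qed

text \<open>If all \<open>y \<in> U\<close> split \<open>S\<close> evenly (\<open>T\<close> small) and all \<open>x \<in> S\<close> split \<open>U\<close> evenly (\<open>B\<close> small), then about
  \<open>k\<^sup>2 card U / (8 D)\<close> cycles are found; for \<open>D\<close> close to \<open>k / 2\<close> this uses nearly all of the
  \<open>k card U\<close> arcs between \<open>S\<close> and \<open>U\<close>. The term with \<open>(2 D - k)\<^sup>2\<close> bounds, in the manner of Chebyshev,
  the contribution of the \<open>y\<close> that have more than \<open>D\<close> in-neighbours or out-neighbours in \<open>S\<close>.\<close>

lemma block_packing: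
  fixes S U :: "'a :: linorder set" and E :: "('a \<times> 'a) set" and D :: nat
  defines "k \<equiv> real (card S)" and "T \<equiv> \<Sum>y\<in>U. (\<Sum>x\<in>S. sgn_arc E y x) ^ 2"
    and "B \<equiv> \<Sum>x\<in>S. \<bar>\<Sum>y\<in>U. sgn_arc E x y\<bar>"
  assumes fin: "finite S" "finite U" and disj: "S \<inter> U = {}" and D: "card S < 2 * D"
    and orient: "\<And>x y. x \<in> S \<Longrightarrow> y \<in> U \<Longrightarrow> (x, y) \<in> E \<longleftrightarrow> (y, x) \<notin> E"
  obtains Q where "c4_packing E Q" "Q \<subseteq> S \<times> U \<times> S \<times> U"
    "(k ^ 2 * real (card U) / 8 - T / 8 - k / 4 * B - k ^ 2 / 2 * (T / (2 * real D - k) ^ 2)) / real D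
       - k ^ 2 * 2 ^ card S \<le> real (card Q)"
proof -
  define G where "G = {y \<in> U. card {x \<in> S. (x, y) \<in> E} \<le> D \<and> card {x \<in> S. (y, x) \<in> E} \<le> D}"
  define P where "P = (\<lambda>x z. {y \<in> G. (x, y) \<in> E \<and> (y, z) \<in> E})"
  define p where "p = (\<lambda>x z. real (card {y \<in> U. (x, y) \<in> E \<and> (y, z) \<in> E}))"
  define bad where "bad = real (card (U - G))"
  define t where "t = (\<lambda>y. \<Sum>x\<in>S. sgn_arc E y x)"
  define c where "c = bad / real D + 2 ^ card S"
  have D0: "D > 0" using D by simp
  obtain A where A: "\<And>x z. A x z \<subseteq> P x z"
    "\<And>x z. x \<in> S \<Longrightarrow> z \<in> S \<Longrightarrow> real (card (P x z)) / real D - 2 ^ card S \<le> real (card (A x z))"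
    "\<And>x z z'. x \<in> S \<Longrightarrow> z \<in> S \<Longrightarrow> z' \<in> S \<Longrightarrow> z \<noteq> z' \<Longrightarrow> A x z \<inter> A x z' = {}"
    "\<And>x x' z. x \<in> S \<Longrightarrow> x' \<in> S \<Longrightarrow> z \<in> S \<Longrightarrow> x \<noteq> x' \<Longrightarrow> A x z \<inter> A x' z = {}"
    using matching_selection[OF fin D0 orient] unfolding G_def P_def by blast
  have path: "y \<in> U \<and> (x, y) \<in> E \<and> (y, z) \<in> E" if "y \<in> A x z" for x y z
    using A(1)[of x z] that by (auto simp: P_def G_def)
  define L where "L = {(x, z) \<in> S \<times> S. x < z}"
  obtain Q where Q: "c4_packing E Q" "Q \<subseteq> S \<times> U \<times> S \<times> U"
    "card Q = (\<Sum>(x, z) \<in> L. min (card (A x z)) (card (A z x)))"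
    using c4_packing_of_matchings[where A = A, OF fin disj path A(3,4)] unfolding L_def by blast
  have finL: "finite L" unfolding L_def using fin by (auto intro: finite_subset[of _ "S \<times> S"])
  have A_ge: "p x z / real D - c \<le> real (card (A x z))" if "x \<in> S" "z \<in> S" for x z
  proof -
    have "card {y \<in> U. (x, y) \<in> E \<and> (y, z) \<in> E} \<le> card (P x z \<union> (U - G))"
      using fin by (intro card_mono) (auto simp: P_def G_def)
    also have "\<dots> \<le> card (P x z) + card (U - G)" by (rule card_Un_le)
    finally have "p x z - bad \<le> real (card (P x z))" by (simp add: p_def bad_def)
    then have "(p x z - bad) / real D \<le> real (card (P x z)) / real D"
      by (intro divide_right_mono) auto
    then show ?thesis using A(2)[OF that] by (simp add: c_def diff_divide_distrib)
  qed
  have bad_le: "bad \<le> T / (2 * real D - k) ^ 2"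
  proof -
    have "(2 * real D - k) ^ 2 \<le> t y ^ 2" if y: "y \<in> U - G" for y
    proof -
      define i where "i = real (card {x \<in> S. (x, y) \<in> E})"
      define o' where "o' = real (card {x \<in> S. (y, x) \<in> E})"
      have o': "o' = (\<Sum>x\<in>S. of_bool ((y, x) \<in> E))" and i: "i = (\<Sum>x\<in>S. of_bool ((x, y) \<in> E))"
        using fin by (simp_all add: o'_def i_def Int_def sum.If_cases of_bool_def)
      have "t y = o' - i" unfolding t_def sgn_arc_def o' i by (simp add: sum_subtractf)
      moreover have "o' + i = k"
      proof -
        have "o' + i = (\<Sum>x\<in>S. 1)" unfolding o' i sum.distrib[symmetric]
          using y orient by (intro sum.cong) auto
        then show ?thesis by (simp add: k_def)
      qed
      moreover have "i > real D \<or> o' > real D" using y by (auto simp: G_def i_def o'_def)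
      \<comment> \<open>With \<open>o' + i = k\<close> and \<open>max o' i > D\<close>, the smaller of the two is less than \<open>k - D\<close>.\<close>
      ultimately have "\<bar>2 * real D - k\<bar> \<le> \<bar>t y\<bar>" using D by (auto simp: k_def)
      then show ?thesis by (simp add: abs_le_square_iff)
    qed
    then have "(\<Sum>y\<in>U - G. (2 * real D - k) ^ 2) \<le> (\<Sum>y\<in>U - G. t y ^ 2)"
      by (intro sum_mono)
    also have "\<dots> \<le> (\<Sum>y\<in>U. t y ^ 2)" using fin by (intro sum_mono2) auto
    finally have "bad * (2 * real D - k) ^ 2 \<le> T" by (simp add: bad_def T_def t_def)
    moreover have "(2 * real D - k) ^ 2 > 0" using D by (simp add: k_def)
    ultimately show ?thesis by (simp add: pos_le_divide_eq)
  qed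
  have "(\<Sum>x\<in>S. \<Sum>z\<in>S. of_bool (x \<noteq> z)) = 2 * (\<Sum>(x, z) \<in> L. of_bool (x \<noteq> z) :: real)"
    unfolding L_def using fin by (intro sum_pairs_symmetric) auto
  moreover have "(\<Sum>(x, z) \<in> L. of_bool (x \<noteq> z) :: real) = (\<Sum>p\<in>L. 1)"
    by (intro sum.cong) (auto simp: L_def)
  moreover have "(\<Sum>x\<in>S. \<Sum>z\<in>S. of_bool (x \<noteq> z)) \<le> (\<Sum>x\<in>S. \<Sum>z\<in>S. 1 :: real)"
    by (intro sum_mono) auto
  ultimately have cardL: "real (card L) \<le> k ^ 2 / 2" by (simp add: k_def power2_eq_square)
  have c0: "c \<ge> 0" by (simp add: c_def bad_def)
  have p_diag: "p x x = 0" if "x \<in> S" for x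
  proof -
    have "{y \<in> U. (x, y) \<in> E \<and> (y, x) \<in> E} = {}" using orient[OF that] by auto
    then show ?thesis unfolding p_def by (metis card.empty of_nat_0)
  qed
  have sum_p: "(\<Sum>x\<in>S. \<Sum>z\<in>S. min (p x z) (p z x)) = 2 * (\<Sum>(x, z) \<in> L. min (p x z) (p z x))"
    unfolding L_def using fin p_diag by (intro sum_pairs_symmetric) (auto simp: min.commute)
  have "(\<Sum>(x, z) \<in> L. min (p x z) (p z x)) / real D - k ^ 2 / 2 * c
      \<le> (\<Sum>(x, z) \<in> L. min (p x z) (p z x)) / real D - real (card L) * c"
    using cardL c0 by (intro diff_left_mono mult_right_mono) auto
  also have "\<dots> = (\<Sum>(x, z) \<in> L. min (p x z) (p z x) / real D - c)"
    by (simp add: sum_subtractf case_prod_unfold sum_divide_distrib)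
  also have "\<dots> \<le> (\<Sum>(x, z) \<in> L. min (real (card (A x z))) (real (card (A z x))))"
  proof (intro sum_mono, clarify)
    fix x z assume "(x, z) \<in> L"
    then have "x \<in> S" "z \<in> S" by (auto simp: L_def)
    then show "min (p x z) (p z x) / real D - c \<le> min (real (card (A x z))) (real (card (A z x)))"
      using A_ge[of x z] A_ge[of z x] by (auto simp: min_def)
        (smt (verit) divide_right_mono of_nat_0_le_iff)+
  qed
  also have "\<dots> = real (card Q)"
    unfolding Q(3) of_nat_sum by (intro sum.cong) (auto simp: of_nat_min)
  finally have *: "(\<Sum>(x, z) \<in> L. min (p x z) (p z x)) / real D - k ^ 2 / 2 * c \<le> real (card Q)" .
  have "(k ^ 2 * real (card U) / 4 - T / 4 - k / 2 * B) \<le> 2 * (\<Sum>(x, z) \<in> L. min (p x z) (p z x))"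
    using sum_min_two_paths[OF fin orient] sum_p unfolding k_def T_def B_def p_def by linarith
  then have "(k ^ 2 * real (card U) / 8 - T / 8 - k / 4 * B) / real D
      \<le> (\<Sum>(x, z) \<in> L. min (p x z) (p z x)) / real D"
    by (intro divide_right_mono) auto
  moreover have "k ^ 2 / 2 * c \<le> k ^ 2 / 2 * (T / (2 * real D - k) ^ 2) / real D + k ^ 2 * 2 ^ card S"
  proof -
    have "k ^ 2 / 2 * (bad / real D) \<le> k ^ 2 / 2 * (T / (2 * real D - k) ^ 2 / real D)"
      using bad_le by (intro mult_left_mono divide_right_mono) auto
    moreover have "k ^ 2 / 2 * 2 ^ card S \<le> k ^ 2 * 2 ^ card S" by simp
    ultimately have "k ^ 2 / 2 * (bad / real D) + k ^ 2 / 2 * 2 ^ card S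
        \<le> k ^ 2 / 2 * (T / (2 * real D - k) ^ 2 / real D) + k ^ 2 * 2 ^ card S" by (rule add_mono)
    then show ?thesis by (simp add: c_def algebra_simps)
  qed
  ultimately have "(k ^ 2 * real (card U) / 8 - T / 8 - k / 4 * B
        - k ^ 2 / 2 * (T / (2 * real D - k) ^ 2)) / real D - k ^ 2 * 2 ^ card S \<le> real (card Q)"
    using * by (simp add: diff_divide_distrib)
  then show thesis using that Q(1,2) by blast
qed

section \<open>Balanced orderings\<close>

text \<open>Under a uniformly random permutation \<open>\<pi>\<close>, the sum of the entries of a row over a random set has the
  variance of a sum of independent signs at most: since the row sums vanish, two different entries of
  a row are not positively correlated.\<close>

lemma random_row_sum:
  fixes s :: "nat \<Rightarrow> nat \<Rightarrow> real"
  assumes diag: "\<And>a. s a a = 0" and row: "\<And>a. a < n \<Longrightarrow> (\<Sum>b<n. s a b) = 0"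
    and bound: "\<And>a b. \<bar>s a b\<bar> \<le> 1" and i: "i < n" "i \<notin> A" and A: "A \<subseteq> {..<n}"
  shows "(\<Sum>\<pi> | \<pi> permutes {..<n}. (\<Sum>a\<in>A. s (\<pi> i) (\<pi> a)) ^ 2) \<le> real (card A) * fact n"
proof -
  define F where "F = (\<lambda>j k. \<Sum>\<pi> | \<pi> permutes {..<n}. s (\<pi> i) (\<pi> j) * s (\<pi> i) (\<pi> k))"
  have finA: "finite A" using A finite_subset by blast
  have sq: "s a b * s a b \<le> 1" for a b
    using bound[of a b] by (metis abs_le_square_iff abs_one power2_eq_square mult_1)
  have off: "F j k \<le> 0" if "j < n" "k < n" "j \<noteq> i" "k \<noteq> i" "j \<noteq> k" for j k
  proof -
    \<comment> \<open>\<open>F j k\<close> does not depend on \<open>k\<close>, so it may be replaced by its average over all other positions.\<close>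
    have inv: "F j k' = F j k" if k': "k' \<in> {..<n} - {i, j}" for k'
    proof -
      have "transpose k k' permutes {..<n}" using k' \<open>k < n\<close> by (intro permutes_swap_id) auto
      from sum_permutations_compose_right[OF this, of "\<lambda>\<pi>. s (\<pi> i) (\<pi> j) * s (\<pi> i) (\<pi> k)"]
      show ?thesis using that k' \<open>j \<noteq> i\<close> \<open>k \<noteq> i\<close> \<open>j \<noteq> k\<close>
        by (auto simp: F_def transpose_def)
    qed
    have row': "(\<Sum>k'\<in>{..<n} - {i, j}. s (\<pi> i) (\<pi> k')) = - s (\<pi> i) (\<pi> j)"
      if \<pi>: "\<pi> permutes {..<n}" for \<pi>
    proof -
      have "(\<Sum>k'<n. s (\<pi> i) (\<pi> k')) = (\<Sum>b<n. s (\<pi> i) b)"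
        using sum.permute[OF \<pi>, of "s (\<pi> i)"] by (simp add: o_def)
      also have "\<dots> = 0" using permutes_in_image[OF \<pi>, of i] i by (intro row) auto
      also have "(\<Sum>k'<n. s (\<pi> i) (\<pi> k'))
          = (\<Sum>k'\<in>{..<n} - {i, j}. s (\<pi> i) (\<pi> k')) + (\<Sum>k'\<in>{i, j}. s (\<pi> i) (\<pi> k'))"
        using i \<open>j < n\<close> by (subst sum.subset_diff[of "{i, j}"]) auto
      finally show ?thesis using \<open>j \<noteq> i\<close> diag by auto
    qed
    have "real (card ({..<n} - {i, j})) * F j k = (\<Sum>k'\<in>{..<n} - {i, j}. F j k')"
      using inv by simp
    also have "\<dots> = (\<Sum>\<pi> | \<pi> permutes {..<n}.
        s (\<pi> i) (\<pi> j) * (\<Sum>k'\<in>{..<n} - {i, j}. s (\<pi> i) (\<pi> k')))"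
      unfolding F_def by (subst sum.swap) (simp add: sum_distrib_left)
    also have "\<dots> \<le> 0"
      using row' by (intro sum_nonpos) auto
    finally have "real (card ({..<n} - {i, j})) * F j k \<le> 0" .
    moreover have "card ({..<n} - {i, j}) > 0"
      using that by (subst card_gt_0_iff) auto
    ultimately show ?thesis by (metis mult_pos_pos not_less of_nat_0_less_iff)
  qed
  have on: "F j j \<le> fact n" for j
  proof -
    have "F j j \<le> (\<Sum>\<pi> | \<pi> permutes {..<n}. 1)" unfolding F_def by (intro sum_mono sq)
    also have "\<dots> = fact n" by (simp add: card_permutations[of "{..<n}" n])
    finally show ?thesis .
  qed
  have "(\<Sum>\<pi> | \<pi> permutes {..<n}. (\<Sum>a\<in>A. s (\<pi> i) (\<pi> a)) ^ 2) = (\<Sum>a\<in>A. \<Sum>a'\<in>A. F a a')"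
  proof -
    have "(\<Sum>\<pi> | \<pi> permutes {..<n}. (\<Sum>a\<in>A. s (\<pi> i) (\<pi> a)) ^ 2)
        = (\<Sum>\<pi> | \<pi> permutes {..<n}. \<Sum>a\<in>A. \<Sum>a'\<in>A. s (\<pi> i) (\<pi> a) * s (\<pi> i) (\<pi> a'))"
      by (simp add: power2_eq_square sum_product)
    also have "\<dots> = (\<Sum>a\<in>A. \<Sum>\<pi> | \<pi> permutes {..<n}. \<Sum>a'\<in>A. s (\<pi> i) (\<pi> a) * s (\<pi> i) (\<pi> a'))"
      by (rule sum.swap)
    also have "\<dots> = (\<Sum>a\<in>A. \<Sum>a'\<in>A. F a a')"
      unfolding F_def by (intro sum.cong refl sum.swap)
    finally show ?thesis .
  qed
  also have "\<dots> \<le> (\<Sum>a\<in>A. \<Sum>a'\<in>A. if a' = a then fact n else 0)"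
    using on off i A by (intro sum_mono) (auto split: if_splits)
  also have "\<dots> = real (card A) * fact n" using finA by simp
  finally show ?thesis .
qed

lemma balanced_ordering:
  fixes s :: "nat \<Rightarrow> nat \<Rightarrow> real" and S U :: "'j \<Rightarrow> nat set"
  assumes diag: "\<And>a. s a a = 0" and row: "\<And>a. a < n \<Longrightarrow> (\<Sum>b<n. s a b) = 0"
    and bound: "\<And>a b. \<bar>s a b\<bar> \<le> 1"
    and sub: "\<And>j. j \<in> J \<Longrightarrow> S j \<subseteq> {..<n}" "\<And>j. j \<in> J \<Longrightarrow> U j \<subseteq> {..<n}"
    and disj: "\<And>j. j \<in> J \<Longrightarrow> S j \<inter> U j = {}"
  obtains \<pi> where "\<pi> permutes {..<n}"
    "(\<Sum>j\<in>J. (\<Sum>x\<in>S j. (\<Sum>y\<in>U j. s (\<pi> x) (\<pi> y)) ^ 2) + (\<Sum>y\<in>U j. (\<Sum>x\<in>S j. s (\<pi> y) (\<pi> x)) ^ 2))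
      \<le> (\<Sum>j\<in>J. 2 * real (card (S j)) * real (card (U j)))"
proof -
  define \<Phi> where "\<Phi> = (\<lambda>\<pi>. \<Sum>j\<in>J. (\<Sum>x\<in>S j. (\<Sum>y\<in>U j. s (\<pi> x) (\<pi> y)) ^ 2)
      + (\<Sum>y\<in>U j. (\<Sum>x\<in>S j. s (\<pi> y) (\<pi> x)) ^ 2))"
  define M where "M = (\<Sum>j\<in>J. 2 * real (card (S j)) * real (card (U j)))"
  let ?P = "{\<pi>. \<pi> permutes {..<n}}"
  have finP: "finite ?P" by (rule finite_permutations) simp
  have half: "(\<Sum>\<pi>\<in>?P. \<Sum>x\<in>X. (\<Sum>y\<in>Y. s (\<pi> x) (\<pi> y)) ^ 2) \<le> real (card X) * real (card Y) * fact n"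
    if "X \<subseteq> {..<n}" "Y \<subseteq> {..<n}" "X \<inter> Y = {}" for X Y
  proof -
    have "(\<Sum>\<pi>\<in>?P. \<Sum>x\<in>X. (\<Sum>y\<in>Y. s (\<pi> x) (\<pi> y)) ^ 2)
        = (\<Sum>x\<in>X. \<Sum>\<pi>\<in>?P. (\<Sum>y\<in>Y. s (\<pi> x) (\<pi> y)) ^ 2)" by (rule sum.swap)
    also have "\<dots> \<le> (\<Sum>x\<in>X. real (card Y) * fact n)"
      using that by (intro sum_mono random_row_sum diag row bound) auto
    finally show ?thesis by (simp add: mult.assoc)
  qed
  have "(\<Sum>\<pi>\<in>?P. \<Phi> \<pi>) = (\<Sum>j\<in>J. \<Sum>\<pi>\<in>?P. (\<Sum>x\<in>S j. (\<Sum>y\<in>U j. s (\<pi> x) (\<pi> y)) ^ 2)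
      + (\<Sum>y\<in>U j. (\<Sum>x\<in>S j. s (\<pi> y) (\<pi> x)) ^ 2))"
    unfolding \<Phi>_def by (rule sum.swap)
  also have "\<dots> \<le> (\<Sum>j\<in>J. 2 * real (card (S j)) * real (card (U j)) * fact n)"
  proof (intro sum_mono)
    fix j assume j: "j \<in> J"
    show "(\<Sum>\<pi>\<in>?P. (\<Sum>x\<in>S j. (\<Sum>y\<in>U j. s (\<pi> x) (\<pi> y)) ^ 2) + (\<Sum>y\<in>U j. (\<Sum>x\<in>S j. s (\<pi> y) (\<pi> x)) ^ 2))
        \<le> 2 * real (card (S j)) * real (card (U j)) * fact n"
      using half[of "S j" "U j"] half[of "U j" "S j"] sub[OF j] disj[OF j]
      by (simp add: sum.distrib Int_commute algebra_simps)
  qed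
  also have "\<dots> = (\<Sum>\<pi>\<in>?P. M)"
    by (simp add: M_def sum_distrib_right[symmetric] card_permutations[of "{..<n}" n])
  finally have "\<not> (\<forall>\<pi>\<in>?P. M < \<Phi> \<pi>)"
    using sum_strict_mono[OF finP, of "\<lambda>_. M" \<Phi>] permutes_id[of "{..<n}"] by fastforce
  then show thesis using that unfolding \<Phi>_def M_def by (auto simp: not_less)
qed

section \<open>Packing 4-cycles in a regular tournament\<close>

text \<open>The vertices are put in a balanced order and cut into \<open>m\<close> blocks of \<open>K\<close> consecutive vertices, and
  the last \<open>n - m K\<close> vertices are left out. A block \<open>S j\<close> is served by the set \<open>U j\<close> of all earlier
  vertices, so that every arc between two blocks belongs to exactly one pair \<open>(S j, U j)\<close>.\<close>

lemma regular_tournament_c4_packing: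
  fixes V :: "'a set" and E :: "('a \<times> 'a) set" and K D m n :: nat
  assumes V: "finite V" "card V = n"
    and orient: "\<And>u v. u \<in> V \<Longrightarrow> v \<in> V \<Longrightarrow> u \<noteq> v \<Longrightarrow> (u, v) \<in> E \<longleftrightarrow> (v, u) \<notin> E"
    and reg: "\<And>v. v \<in> V \<Longrightarrow> card {u \<in> V. (v, u) \<in> E} = card {u \<in> V. (u, v) \<in> E}"
    and K: "0 < K" "K < 2 * D" "m * K \<le> n" and n: "n > 0"
  defines "k \<equiv> real K"
  shows "\<exists>Q. c4_packing E Q \<and>
    (k ^ 3 * real m * (real m - 1) / 16 - (1 / 8 + k ^ 2 / (2 * (2 * real D - k) ^ 2)) * real n ^ 2
      - k / 4 * real n * sqrt (real n)) / real D - real m * (k ^ 2 * 2 ^ K) \<le> real (card Q)"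
proof -
  obtain h where h: "bij_betw h {..<n} V"
    using ex_bij_betw_nat_finite[OF V(1)] V(2) by (auto simp: atLeast0LessThan)
  define s where "s = (\<lambda>a b. if a < n \<and> b < n then sgn_arc E (h a) (h b) else 0)"
  have diag: "s a a = 0" for a by (simp add: s_def sgn_arc_def)
  have bound: "\<bar>s a b\<bar> \<le> 1" for a b by (simp add: s_def sgn_arc_def)
  have row: "(\<Sum>b<n. s a b) = 0" if a: "a < n" for a
  proof -
    have ha: "h a \<in> V" using h a by (auto simp: bij_betw_def)
    have "(\<Sum>b<n. s a b) = (\<Sum>b<n. sgn_arc E (h a) (h b))"
      using a by (intro sum.cong) (auto simp: s_def)
    also have "\<dots> = (\<Sum>v\<in>V. sgn_arc E (h a) v)" by (rule sum.reindex_bij_betw[OF h])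
    also have "\<dots> = real (card {u \<in> V. (h a, u) \<in> E}) - real (card {u \<in> V. (u, h a) \<in> E})"
      using V by (simp add: sgn_arc_def sum_subtractf Int_def of_bool_def sum.If_cases)
    finally show ?thesis using reg[OF ha] by simp
  qed
  define S where "S = (\<lambda>j. {j * K..<Suc j * K})"
  define U where "U = (\<lambda>j. {..<j * K})"
  have le: "Suc j * K \<le> n" if "j < m" for j
    using K(3) mult_le_mono1[of "Suc j" m K] that by linarith
  have sub: "S j \<subseteq> {..<n}" "U j \<subseteq> {..<n}" if "j \<in> {..<m}" for j
    using le[of j] that by (auto simp: S_def U_def)
  have disj: "S j \<inter> U j = {}" for j by (auto simp: S_def U_def)
  have card_SU: "card (S j) = K" "card (U j) = j * K" for j by (auto simp: S_def U_def)
  have fin_SU: "finite (S j)" "finite (U j)" for j by (auto simp: S_def U_def)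
  obtain \<pi> where \<pi>: "\<pi> permutes {..<n}"
    "(\<Sum>j<m. (\<Sum>x\<in>S j. (\<Sum>y\<in>U j. s (\<pi> x) (\<pi> y)) ^ 2) + (\<Sum>y\<in>U j. (\<Sum>x\<in>S j. s (\<pi> y) (\<pi> x)) ^ 2))
      \<le> (\<Sum>j<m. 2 * real (card (S j)) * real (card (U j)))"
    using balanced_ordering[of s n "{..<m}" S U] diag row bound sub disj by blast
  define g where "g = h \<circ> \<pi>"
  have bij_g: "bij_betw g {..<n} V"
    unfolding g_def using permutes_imp_bij[OF \<pi>(1)] h by (rule bij_betw_trans)
  define F where "F = {(a, b). a < n \<and> b < n \<and> (g a, g b) \<in> E}"
  have s_F: "s (\<pi> a) (\<pi> b) = sgn_arc F a b" if "a < n" "b < n" for a b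
    using that permutes_in_image[OF \<pi>(1)] by (auto simp: s_def sgn_arc_def F_def g_def)
  define T where "T = (\<lambda>j. \<Sum>y\<in>U j. (\<Sum>x\<in>S j. sgn_arc F y x) ^ 2)"
  define R where "R = (\<lambda>j. \<Sum>x\<in>S j. (\<Sum>y\<in>U j. sgn_arc F x y) ^ 2)"
  define B where "B = (\<lambda>j. \<Sum>x\<in>S j. \<bar>\<Sum>y\<in>U j. sgn_arc F x y\<bar>)"
  have sum_nat: "(\<Sum>j<l. real j) = real l * (real l - 1) / 2" for l :: nat
    by (induction l) (auto simp: field_simps)
  have mK: "real m * k \<le> real n"
    using K(3) unfolding k_def by (metis of_nat_le_iff of_nat_mult)
  have RT: "(\<Sum>j<m. R j + T j) \<le> real n ^ 2"
  proof -
    have "(\<Sum>j<m. R j + T j) \<le> (\<Sum>j<m. 2 * real (card (S j)) * real (card (U j)))"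
    proof -
      have "(\<Sum>y\<in>U j. s (\<pi> x) (\<pi> y)) = (\<Sum>y\<in>U j. sgn_arc F x y)" if "x \<in> S j" "j < m" for x j
        using that sub[of j] by (intro sum.cong s_F) auto
      moreover have "(\<Sum>x\<in>S j. s (\<pi> y) (\<pi> x)) = (\<Sum>x\<in>S j. sgn_arc F y x)" if "y \<in> U j" "j < m" for y j
        using that sub[of j] by (intro sum.cong s_F) auto
      ultimately show ?thesis using \<pi>(2) by (simp add: R_def T_def)
    qed
    also have "\<dots> = 2 * k ^ 2 * (\<Sum>j<m. real j)"
      by (simp add: card_SU k_def sum_distrib_left power2_eq_square algebra_simps)
    also have "\<dots> = (real m * k) ^ 2 - k ^ 2 * real m"
      unfolding sum_nat by (simp add: power2_eq_square field_simps)
    also have "\<dots> \<le> (real m * k) ^ 2" by simp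
    also have "\<dots> \<le> real n ^ 2" using mK by (intro power_mono) (auto simp: k_def)
    finally show ?thesis .
  qed
  have nonneg: "R j \<ge> 0" "T j \<ge> 0" for j by (auto simp: R_def T_def intro!: sum_nonneg)
  have sum_T: "(\<Sum>j<m. T j) \<le> real n ^ 2"
    using RT sum_nonneg[of "{..<m}" R] nonneg by (simp add: sum.distrib)
  have sum_R: "(\<Sum>j<m. R j) \<le> real n ^ 2"
    using RT sum_nonneg[of "{..<m}" T] nonneg by (simp add: sum.distrib)
  define l where "l = sqrt (real n)"
  have l: "l > 0" "l * l = real n" using n by (auto simp: l_def)
  have sum_B: "(\<Sum>j<m. B j) \<le> real n * l"
  proof -
    \<comment> \<open>The factor \<open>l\<close> makes both halves of the bound of order \<open>n powr (3 / 2)\<close>.\<close>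
    have amgm: "\<bar>b\<bar> \<le> (b ^ 2 / l + l) / 2" for b :: real
    proof -
      have "0 \<le> (\<bar>b\<bar> - l) ^ 2" by simp
      then have "2 * \<bar>b\<bar> * l \<le> b ^ 2 + l * l" by (simp add: power2_eq_square algebra_simps)
      then show ?thesis using l by (simp add: field_simps)
    qed
    have "B j \<le> R j / (2 * l) + k * l / 2" for j
    proof -
      have "B j \<le> (\<Sum>x\<in>S j. ((\<Sum>y\<in>U j. sgn_arc F x y) ^ 2 / l + l) / 2)"
        unfolding B_def by (intro sum_mono amgm)
      also have "\<dots> = (R j / l + k * l) / 2"
        by (simp only: sum_divide_distrib[symmetric] sum.distrib R_def sum_constant card_SU k_def)
      finally show ?thesis by (simp add: field_simps)
    qed
    then have "(\<Sum>j<m. B j) \<le> (\<Sum>j<m. R j / (2 * l) + k * l / 2)" by (intro sum_mono)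
    also have "\<dots> = (\<Sum>j<m. R j) / (2 * l) + real m * k * l / 2"
      by (simp add: sum.distrib sum_divide_distrib)
    also have "\<dots> \<le> real n ^ 2 / (2 * l) + real n * l / 2"
      using sum_R mK l by (intro add_mono divide_right_mono mult_right_mono) auto
    also have "real n ^ 2 / (2 * l) = real n * l / 2"
      using l by (simp add: power2_eq_square field_simps)
    finally show ?thesis by (simp add: mult.commute)
  qed
  define \<tau> where "\<tau> = (2 * real D - k) ^ 2"
  have "\<exists>Q. c4_packing F Q \<and> Q \<subseteq> S j \<times> U j \<times> S j \<times> U j \<and>
    (k ^ 2 * (real j * k) / 8 - T j / 8 - k / 4 * B j - k ^ 2 / 2 * (T j / \<tau>)) / real D
       - k ^ 2 * 2 ^ K \<le> real (card Q)" if j: "j < m" for j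
  proof -
    have orient_F: "(x, y) \<in> F \<longleftrightarrow> (y, x) \<notin> F" if "x \<in> S j" "y \<in> U j" for x y
    proof -
      have xy: "x < n" "y < n" "x \<noteq> y" using that sub[of j] j disj[of j] by auto
      then have "g x \<noteq> g y" "g x \<in> V" "g y \<in> V" using bij_g by (auto simp: bij_betw_def inj_on_def)
      then have "(g x, g y) \<in> E \<longleftrightarrow> (g y, g x) \<notin> E" by (intro orient)
      then show ?thesis using xy by (simp add: F_def)
    qed
    have D: "card (S j) < 2 * D" using K by (simp add: card_SU)
    obtain Q where "c4_packing F Q" "Q \<subseteq> S j \<times> U j \<times> S j \<times> U j"
      "(real (card (S j)) ^ 2 * real (card (U j)) / 8 - T j / 8 - real (card (S j)) / 4 * B j
        - real (card (S j)) ^ 2 / 2 * (T j / (2 * real D - real (card (S j))) ^ 2)) / real D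
       - real (card (S j)) ^ 2 * 2 ^ card (S j) \<le> real (card Q)"
      using block_packing[OF fin_SU disj D orient_F] unfolding T_def B_def by blast
    then show ?thesis unfolding card_SU \<tau>_def k_def of_nat_mult by blast
  qed
  then obtain Q where Q: "\<And>j. j < m \<Longrightarrow> c4_packing F (Q j)"
    "\<And>j. j < m \<Longrightarrow> Q j \<subseteq> S j \<times> U j \<times> S j \<times> U j"
    "\<And>j. j < m \<Longrightarrow> (k ^ 2 * (real j * k) / 8 - T j / 8 - k / 4 * B j - k ^ 2 / 2 * (T j / \<tau>)) / real D
       - k ^ 2 * 2 ^ K \<le> real (card (Q j))"
    by metis
  \<comment> \<open>The larger end of an arc determines the index \<open>j\<close> of the pair \<open>(S j, U j)\<close> that it belongs to.\<close>
  have blk: "max (fst e) (snd e) div K = j" if "q \<in> Q j" "j < m" "e \<in> c4_arcs q" for e q j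
  proof -
    have *: "max a b div K = j \<and> max b a div K = j" if "a \<in> S j" "b \<in> U j" for a b
    proof -
      have "max a b = a" "max b a = a" using that by (auto simp: S_def U_def)
      moreover have "a div K = j" using that by (intro div_nat_eqI) (auto simp: S_def mult.commute)
      ultimately show ?thesis by simp
    qed
    obtain x y z w where "q = (x, y, z, w)" by (cases q) auto
    moreover have "x \<in> S j" "z \<in> S j" "y \<in> U j" "w \<in> U j" using Q(2)[OF that(2)] that calculation by auto
    ultimately show ?thesis using that * by (auto simp: c4_arcs_def)
  qed
  have Qdisj: "c4_arcs p \<inter> c4_arcs q = {}"
    if "i \<in> {..<m}" "j \<in> {..<m}" "i \<noteq> j" "p \<in> Q i" "q \<in> Q j" for i j p q
    using blk[of p i] blk[of q j] that by fastforce
  have Q': "c4_packing F (\<Union>j<m. Q j)" "card (\<Union>j<m. Q j) = (\<Sum>j<m. card (Q j))"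
    using c4_packing_UN[of "{..<m}" F Q, OF _ Q(1) Qdisj] by auto
  have "\<exists>P. c4_packing E P \<and> card P = card (\<Union>j<m. Q j)"
    by (rule c4_packing_image[OF Q'(1), of "{..<n}" g]) (use bij_g in \<open>auto simp: F_def bij_betw_def\<close>)
  then obtain P where P: "c4_packing E P" "card P = (\<Sum>j<m. card (Q j))" using Q'(2) by auto
  have "(k ^ 3 * real m * (real m - 1) / 16 - (1 / 8 + k ^ 2 / (2 * \<tau>)) * real n ^ 2
      - k / 4 * (real n * l)) / real D - real m * (k ^ 2 * 2 ^ K)
    \<le> (k ^ 3 * real m * (real m - 1) / 16 - (1 / 8 + k ^ 2 / (2 * \<tau>)) * (\<Sum>j<m. T j)
      - k / 4 * (\<Sum>j<m. B j)) / real D - real m * (k ^ 2 * 2 ^ K)"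
    using sum_T sum_B
    by (intro diff_right_mono divide_right_mono diff_mono mult_left_mono order_refl)
      (auto simp: k_def \<tau>_def)
  also have "\<dots> = (k ^ 3 / 8 * (\<Sum>j<m. real j) - (1 / 8 + k ^ 2 / (2 * \<tau>)) * (\<Sum>j<m. T j)
      - k / 4 * (\<Sum>j<m. B j)) / real D - real m * (k ^ 2 * 2 ^ K)"
    by (simp add: sum_nat)
  also have "\<dots> = (\<Sum>j<m. (k ^ 3 / 8 * real j - (1 / 8 + k ^ 2 / (2 * \<tau>)) * T j
      - k / 4 * B j) / real D - k ^ 2 * 2 ^ K)"
    by (simp add: sum_subtractf sum_distrib_left sum_divide_distrib diff_divide_distrib)
  also have "\<dots> \<le> (\<Sum>j<m. real (card (Q j)))"
  proof (intro sum_mono)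
    fix j assume j: "j \<in> {..<m}"
    have eq: "k ^ 3 / 8 * real j - (1 / 8 + k ^ 2 / (2 * \<tau>)) * T j - k / 4 * B j
        = k ^ 2 * (real j * k) / 8 - T j / 8 - k / 4 * B j - k ^ 2 / 2 * (T j / \<tau>)"
      by (simp add: power2_eq_square power3_eq_cube algebra_simps)
    show "(k ^ 3 / 8 * real j - (1 / 8 + k ^ 2 / (2 * \<tau>)) * T j - k / 4 * B j) / real D
        - k ^ 2 * 2 ^ K \<le> real (card (Q j))"
      unfolding eq using j by (intro Q(3)) simp
  qed
  also have "\<dots> = real (card P)" using P(2) by simp
  finally show ?thesis using P(1) unfolding \<tau>_def l_def by (auto simp: mult.assoc)
qed

text \<open>The leading coefficient of the previous bound is \<open>(K / 16 - 1 / 8 - K\<^sup>2 / (2 (2 D - K)\<^sup>2)) / D\<close>. It tends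
  to \<open>1 / 8\<close> when \<open>K\<close> tends to infinity and \<open>D = (1 + \<delta>) K / 2\<close> for a \<open>\<delta>\<close> that tends to \<open>0\<close>
  sufficiently slowly. The choice \<open>K = 10000\<close>, \<open>D = 5500\<close> makes it larger than \<open>1 / 10\<close>.\<close>

lemma many_c4_in_regular_tournament:
  obtains N where "\<And>n (V :: 'a set) E. n > N \<Longrightarrow> finite V \<Longrightarrow> card V = n \<Longrightarrow>
     (\<And>u v. u \<in> V \<Longrightarrow> v \<in> V \<Longrightarrow> u \<noteq> v \<Longrightarrow> (u, v) \<in> E \<longleftrightarrow> (v, u) \<notin> E) \<Longrightarrow>
     (\<And>v. v \<in> V \<Longrightarrow> card {u \<in> V. (v, u) \<in> E} = card {u \<in> V. (u, v) \<in> E}) \<Longrightarrow>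
     \<exists>Q. c4_packing E Q \<and> 3 / 40 * real n ^ 2 \<le> real (card Q)"
proof -
  \<comment> \<open>\<open>K\<close> and \<open>C\<close> are kept opaque so that \<open>2 ^ 10000\<close> is never evaluated.\<close>
  obtain K :: nat where K: "K = 10000" by blast
  obtain C :: real where C: "C = real K ^ 2 * 2 ^ K" by blast
  have C0: "C \<ge> 0" unfolding C by simp
  have "\<forall>\<^sub>F n in at_top. 3 / 40 * real n ^ 2 \<le>
    (10000 ^ 3 * (real n / 10000 - 1) * (real n / 10000 - 2) / 16
      - (1 / 8 + 10000 ^ 2 / (2 * (2 * 5500 - 10000) ^ 2)) * real n ^ 2
      - 10000 / 4 * real n * sqrt (real n)) / 5500 - real n * C"
    by real_asymp
  then obtain N where N: "\<And>n. n \<ge> N \<Longrightarrow> 3 / 40 * real n ^ 2 \<le>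
    (10000 ^ 3 * (real n / 10000 - 1) * (real n / 10000 - 2) / 16
      - (1 / 8 + 10000 ^ 2 / (2 * (2 * 5500 - 10000) ^ 2)) * real n ^ 2
      - 10000 / 4 * real n * sqrt (real n)) / 5500 - real n * C"
    by (auto simp: eventually_at_top_linorder)
  show thesis
  proof (rule that[of "max N 20000"])
    fix n and V :: "'a set" and E
    assume n: "n > max N 20000" and V: "finite V" "card V = n"
      and orient: "\<And>u v. u \<in> V \<Longrightarrow> v \<in> V \<Longrightarrow> u \<noteq> v \<Longrightarrow> (u, v) \<in> E \<longleftrightarrow> (v, u) \<notin> E"
      and reg: "\<And>v. v \<in> V \<Longrightarrow> card {u \<in> V. (v, u) \<in> E} = card {u \<in> V. (u, v) \<in> E}"
    have K': "0 < K" "K < 2 * 5500" and n': "n > 0" using K n by auto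
    define m where "m = n div K"
    have mK: "m * K \<le> n" "m \<le> n" by (auto simp: m_def)
    obtain Q where Q: "c4_packing E Q" and Q_ge:
      "(real K ^ 3 * real m * (real m - 1) / 16
        - (1 / 8 + real K ^ 2 / (2 * (2 * real 5500 - real K) ^ 2)) * real n ^ 2
        - real K / 4 * real n * sqrt (real n)) / real 5500 - real m * (real K ^ 2 * 2 ^ K) \<le> real (card Q)"
      using regular_tournament_c4_packing[OF V orient reg K' mK(1) n'] by blast
    have m_ge: "real n / 10000 - 1 \<le> real m"
      using floor_divide_of_nat_eq[of n K, where ?'a = real] K unfolding m_def by simp
    have m_sq: "(real n / 10000 - 1) * (real n / 10000 - 2) \<le> real m * (real m - 1)"
      using m_ge n by (intro mult_mono) auto
    have main: "10000 ^ 3 * (real n / 10000 - 1) * (real n / 10000 - 2) / 16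
        \<le> 10000 ^ 3 * real m * (real m - 1) / 16"
      unfolding mult.assoc by (intro divide_right_mono mult_left_mono m_sq) auto
    have rest: "real m * C \<le> real n * C" using mK C0 by (intro mult_right_mono) auto
    have "3 / 40 * real n ^ 2 \<le>
      (10000 ^ 3 * (real n / 10000 - 1) * (real n / 10000 - 2) / 16
        - (1 / 8 + 10000 ^ 2 / (2 * (2 * 5500 - 10000) ^ 2)) * real n ^ 2
        - 10000 / 4 * real n * sqrt (real n)) / 5500 - real n * C"
      using n by (intro N) simp
    also have "\<dots> \<le> (10000 ^ 3 * real m * (real m - 1) / 16
        - (1 / 8 + 10000 ^ 2 / (2 * (2 * 5500 - 10000) ^ 2)) * real n ^ 2
        - 10000 / 4 * real n * sqrt (real n)) / 5500 - real m * C"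
      by (intro diff_mono[OF _ rest] divide_right_mono diff_right_mono main) simp
    also have "\<dots> \<le> real (card Q)"
      using Q_ge unfolding C[symmetric] unfolding K of_nat_numeral .
    finally have "3 / 40 * real n ^ 2 \<le> real (card Q)" .
    then show "\<exists>Q. c4_packing E Q \<and> 3 / 40 * real n ^ 2 \<le> real (card Q)" using Q by blast
  qed
qed

section \<open>From quadruples to subdigraphs\<close>

text \<open>The subdigraph on the vertices of \<open>q\<close> whose arcs are those arcs of \<open>T\<close> that have their ends in
  \<open>c4_arcs q\<close>. As each of the four vertices is the tail of an arc, the first components are all vertices.\<close>

definition c4_subdigraph :: "('a, 'b) pre_digraph \<Rightarrow> 'a \<times> 'a \<times> 'a \<times> 'a \<Rightarrow> ('a, 'b) pre_digraph" where
  "c4_subdigraph T q = \<lparr>verts = fst ` c4_arcs q, arcs = {e \<in> arcs T. arc_to_ends T e \<in> c4_arcs q},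
     tail = tail T, head = head T\<rparr>"

lemma directed_cycle_4:
  "verts (directed_cycle 4) = {0, 1, 2, 3}"
  "arcs (directed_cycle 4) = {(0, 1), (1, 2), (2, 3), (3, 0)}"
  "tail (directed_cycle 4) = fst" "head (directed_cycle 4) = snd"
proof -
  have *: "{..<4} = {0, 1, 2, 3 :: nat}" by auto
  show "verts (directed_cycle 4) = {0, 1, 2, 3}" by (simp add: directed_cycle_def *)
  have "{(i, Suc i mod 4) |i. i < 4} = (\<lambda>i. (i, Suc i mod 4)) ` {..<4}" by auto
  also have "\<dots> = {(0, 1), (1, 2), (2, 3), (3, 0)}" unfolding * by simp (simp add: numeral_2_eq_2)
  finally show "arcs (directed_cycle 4) = {(0, 1), (1, 2), (2, 3), (3, 0)}"
    by (simp add: directed_cycle_def)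
qed (simp_all add: directed_cycle_def)

lemma (in tournament) c4_subdigraph_is_copy:
  assumes q: "c4_arcs q \<subseteq> arcs_ends T"
  shows "is_copy (c4_subdigraph T q) (directed_cycle 4) T"
proof -
  obtain x y z w where q_eq: "q = (x, y, z, w)" by (cases q) auto
  let ?H = "c4_subdigraph T q"
  have dom: "x \<rightarrow>\<^bsub>T\<^esub> y" "y \<rightarrow>\<^bsub>T\<^esub> z" "z \<rightarrow>\<^bsub>T\<^esub> w" "w \<rightarrow>\<^bsub>T\<^esub> x"
    using q by (auto simp: q_eq c4_arcs_def)
  have V: "x \<in> verts T" "y \<in> verts T" "z \<in> verts T" "w \<in> verts T" using dom by auto
  have ne: "a \<noteq> b" if "a \<rightarrow>\<^bsub>T\<^esub> b" for a b using that adj_not_same by blast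
  have dist: "x \<noteq> y" "y \<noteq> z" "z \<noteq> w" "w \<noteq> x" using dom ne by auto
  have dist': "x \<noteq> z" "y \<noteq> w" using dom orientation V dist by blast+
  define \<phi> :: "_ \<Rightarrow> nat" where
    "\<phi> = (\<lambda>v. if v = x then 0 else if v = y then 1 else if v = z then 2 else 3)"
  have \<phi>: "\<phi> x = 0" "\<phi> y = 1" "\<phi> z = 2" "\<phi> w = 3" using dist dist' by (auto simp: \<phi>_def)
  have H: "verts ?H = {x, y, z, w}" "tail ?H = tail T" "head ?H = head T"
    "arcs ?H = {e \<in> arcs T. arc_to_ends T e \<in> c4_arcs q}"
    by (auto simp: c4_subdigraph_def q_eq c4_arcs_def)
  have ends: "arc_to_ends T ` arcs ?H = c4_arcs q"
    using q by (auto simp: H arcs_ends_def)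
  have wf: "wf_digraph ?H"
    by unfold_locales (auto simp: c4_subdigraph_def q_eq c4_arcs_def arc_to_ends_def)
  have sub: "subgraph ?H T"
    using V wf by (intro subgraphI) (auto simp: H compatible_def wf_digraph_axioms)
  define f where "f = \<lparr>iso_verts = \<phi>, iso_arcs = map_prod \<phi> \<phi> \<circ> arc_to_ends T,
    iso_head = snd, iso_tail = (fst :: nat \<times> nat \<Rightarrow> nat)\<rparr>"
  have inj_v: "inj_on \<phi> {x, y, z, w}" by (auto simp: inj_on_def \<phi>)
  have inj_a: "inj_on (map_prod \<phi> \<phi> \<circ> arc_to_ends T) (arcs ?H)"
  proof (rule comp_inj_on)
    show "inj_on (arc_to_ends T) (arcs ?H)" using no_multi_arcs by (auto simp: inj_on_def H)
    have "inj_on (map_prod \<phi> \<phi>) ({x, y, z, w} \<times> {x, y, z, w})"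
      using map_prod_inj_on[OF inj_v inj_v] .
    then show "inj_on (map_prod \<phi> \<phi>) (arc_to_ends T ` arcs ?H)"
      unfolding ends by (rule inj_on_subset) (auto simp: q_eq c4_arcs_def)
  qed
  have "pre_digraph.digraph_isomorphism ?H f"
    unfolding pre_digraph.digraph_isomorphism_def
    using wf inj_v inj_a by (auto simp: f_def H arc_to_ends_def)
  moreover have "directed_cycle 4 = app_iso f ?H"
  proof (rule pre_digraph.equality)
    show "verts (directed_cycle 4) = verts (app_iso f ?H)"
      by (simp add: directed_cycle_4 verts_app_iso f_def H \<phi>)
    have "arcs (app_iso f ?H) = map_prod \<phi> \<phi> ` c4_arcs q"
      by (simp add: arcs_app_iso f_def ends[symmetric] image_image)
    then show "arcs (directed_cycle 4) = arcs (app_iso f ?H)"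
      by (simp add: directed_cycle_4 q_eq c4_arcs_def \<phi>)
  qed (simp_all add: directed_cycle_4 tail_app_iso head_app_iso f_def)
  ultimately show ?thesis using sub unfolding is_copy_def digraph_iso_def by blast
qed

lemma (in regular_tournament) card_dominates:
  assumes v: "v \<in> verts T"
  shows "card {u \<in> verts T. v \<rightarrow>\<^bsub>T\<^esub> u} = card {u \<in> verts T. u \<rightarrow>\<^bsub>T\<^esub> v}"
proof -
  have "{u \<in> verts T. v \<rightarrow>\<^bsub>T\<^esub> u} = head T ` out_arcs T v"
    by (auto simp: arcs_ends_def arc_to_ends_def out_arcs_def)
  moreover have "inj_on (head T) (out_arcs T v)"
    using no_multi_arcs by (auto simp: inj_on_def out_arcs_def arc_to_ends_def)
  moreover have "{u \<in> verts T. u \<rightarrow>\<^bsub>T\<^esub> v} = tail T ` in_arcs T v"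
    by (auto simp: arcs_ends_def arc_to_ends_def in_arcs_def)
  moreover have "inj_on (tail T) (in_arcs T v)"
    using no_multi_arcs by (auto simp: inj_on_def in_arcs_def arc_to_ends_def)
  ultimately show ?thesis
    using regular[OF v] by (simp add: card_image in_degree_def out_degree_def)
qed

lemma (in tournament) c4_packing_subdigraphs:
  assumes Q: "c4_packing (arcs_ends T) Q"
  shows "\<exists>\<C>. finite \<C> \<and> (\<forall>H\<in>\<C>. is_copy H (directed_cycle 4) T) \<and>
    pairwise arc_disjoint \<C> \<and> card \<C> = card Q"
proof -
  have disj: "arc_disjoint (c4_subdigraph T p) (c4_subdigraph T q)"
    if "p \<in> Q" "q \<in> Q" "p \<noteq> q" for p q
  proof -
    have "c4_arcs p \<inter> c4_arcs q = {}" using that Q by (auto simp: c4_packing_def pairwise_def)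
    then show ?thesis by (auto simp: arc_disjoint_def c4_subdigraph_def)
  qed
  have ne: "arcs (c4_subdigraph T p) \<noteq> {}" if "p \<in> Q" for p
  proof -
    have "c4_arcs p \<subseteq> arcs_ends T" using that Q by (auto simp: c4_packing_def)
    moreover have "c4_arcs p \<noteq> {}" by (cases p) (simp add: c4_arcs_def)
    ultimately show ?thesis by (fastforce simp: c4_subdigraph_def arcs_ends_def)
  qed
  have "inj_on (c4_subdigraph T) Q"
    using disj ne by (fastforce simp: inj_on_def arc_disjoint_def)
  then have "card (c4_subdigraph T ` Q) = card Q" by (rule card_image)
  moreover have "\<forall>H\<in>c4_subdigraph T ` Q. is_copy H (directed_cycle 4) T"
    using Q c4_subdigraph_is_copy by (auto simp: c4_packing_def)
  moreover have "pairwise arc_disjoint (c4_subdigraph T ` Q)"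
    using disj unfolding pairwise_def by blast
  ultimately show ?thesis using Q by (intro exI[of _ "c4_subdigraph T ` Q"]) (auto simp: c4_packing_def)
qed

theorem theorem1p3:
  shows "\<forall>\<epsilon>::real. \<epsilon> > 0 \<longrightarrow>
    (\<exists>N::nat. \<forall>n>N. \<forall>T :: ('a, 'b) pre_digraph.
      regular_tournament T \<and> card (verts T) = n \<longrightarrow>
      (\<exists>\<C>. finite \<C> \<and>
         (\<forall>H\<in>\<C>. is_copy H (directed_cycle 4) T) \<and>
         pairwise arc_disjoint \<C> \<and>
         real (card \<C>) \<ge> 1 / (8 + sqrt 32) * (real n)\<^sup>2 * (1 - \<epsilon>)))"
proof (intro allI impI)
  fix \<epsilon> :: real assume \<epsilon>: "\<epsilon> > 0"
  \<comment> \<open>Any constant between \<open>1 / (8 + sqrt 32) = 0.0732...\<close> and \<open>1 / 10\<close> could replace \<open>3 / 40\<close>.\<close>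
  have "16 / 3 \<le> sqrt 32" by (rule real_le_rsqrt) (simp add: power2_eq_square)
  then have const: "1 / (8 + sqrt 32) \<le> 3 / 40" by (simp add: field_simps)
  have bound: "1 / (8 + sqrt 32) * (real n)\<^sup>2 * (1 - \<epsilon>) \<le> 3 / 40 * real n ^ 2" for n
  proof -
    have "1 / (8 + sqrt 32) * (real n)\<^sup>2 * (1 - \<epsilon>) \<le> 1 / (8 + sqrt 32) * (real n)\<^sup>2 * 1"
      using \<epsilon> by (intro mult_left_mono) auto
    also have "\<dots> \<le> 3 / 40 * real n ^ 2" using mult_right_mono[OF const, of "(real n)\<^sup>2"] by simp
    finally show ?thesis .
  qed
  show "\<exists>N::nat. \<forall>n>N. \<forall>T :: ('a, 'b) pre_digraph.
      regular_tournament T \<and> card (verts T) = n \<longrightarrow>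
      (\<exists>\<C>. finite \<C> \<and>
         (\<forall>H\<in>\<C>. is_copy H (directed_cycle 4) T) \<and>
         pairwise arc_disjoint \<C> \<and>
         real (card \<C>) \<ge> 1 / (8 + sqrt 32) * (real n)\<^sup>2 * (1 - \<epsilon>))"
  proof (rule many_c4_in_regular_tournament[where 'a = 'a])
    fix N assume N: "\<And>n (V :: 'a set) E. n > N \<Longrightarrow> finite V \<Longrightarrow> card V = n \<Longrightarrow>
      (\<And>u v. u \<in> V \<Longrightarrow> v \<in> V \<Longrightarrow> u \<noteq> v \<Longrightarrow> (u, v) \<in> E \<longleftrightarrow> (v, u) \<notin> E) \<Longrightarrow>
      (\<And>v. v \<in> V \<Longrightarrow> card {u \<in> V. (v, u) \<in> E} = card {u \<in> V. (u, v) \<in> E}) \<Longrightarrow>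
      \<exists>Q. c4_packing E Q \<and> 3 / 40 * real n ^ 2 \<le> real (card Q)"
    show ?thesis
    proof (intro exI[of _ N] allI impI, elim conjE)
      fix n and T :: "('a, 'b) pre_digraph"
      assume n: "n > N" and T: "regular_tournament T" and card: "card (verts T) = n"
      interpret regular_tournament T by fact
      obtain Q where Q: "c4_packing (arcs_ends T) Q" "3 / 40 * real n ^ 2 \<le> real (card Q)"
        using N[OF n finite_verts card orientation card_dominates] by blast
      obtain \<C> where \<C>: "finite \<C>" "\<forall>H\<in>\<C>. is_copy H (directed_cycle 4) T"
          "pairwise arc_disjoint \<C>" "card \<C> = card Q"
        using c4_packing_subdigraphs[OF Q(1)] by blast
      have "1 / (8 + sqrt 32) * (real n)\<^sup>2 * (1 - \<epsilon>) \<le> real (card \<C>)"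
        unfolding \<C>(4) by (rule order_trans[OF bound Q(2)])
      then show "\<exists>\<C>. finite \<C> \<and> (\<forall>H\<in>\<C>. is_copy H (directed_cycle 4) T) \<and>
           pairwise arc_disjoint \<C> \<and>
           real (card \<C>) \<ge> 1 / (8 + sqrt 32) * (real n)\<^sup>2 * (1 - \<epsilon>)"
        using \<C>(1-3) by blast
    qed
  qed
qed

end
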